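(* Let $U$, $\mathbf u^*$, the samples $\boldsymbol\nu^1,\dots,\boldsymbol\nu^M$ and the snapshot matrices $\mathbf S^r$ be as in the context. Let $\mathcal U^r_{1:q}$ be the subspace of $\mathbb R^{\mathcal M}$ spanned by the first $q$ left singular vectors of $\mathbf S^r$, and let $T_0^*=\mathrm{span}\big(\tfrac{\partial U}{\partial\nu_1}(\boldsymbol 0),\dots,\tfrac{\partial U}{\partial\nu_q}(\boldsymbol 0)\big)$ be the tangent space. As $r\to0$, $\mathcal U^r_{1:q}$ converges to $T_0^*$ with rate $\mathcal O(r)$, i.e. \[ \|\sin\mathbf\Theta(\mathcal U^r_{1:q},T_0^* )\|=\mathcal O(r). \]
   Context: Setting. $\mathcal S$ is an embedded submanifold of dimension $q$ of $\mathbb R^{\mathcal M}$ ($\mathcal M\gg q$), and $\mathbf u^*\in\mathcal S$. $U:\mathcal Q^0\to\mathbb R^{\mathcal M}$ is the inverse of a chart of $\mathcal S$ around $\mathbf u^*$: $\mathcal Q^0\subset\mathbb R^q$ is open and contains the unit ball $\mathcal B(\boldsymbol 0,1)$, $U$ is a homeomorphism onto an open subset of $\mathcal S$, and $U(\boldsymbol 0)=\mathbf u^*$. Standing assumptions: $U$ is of class $C^3$; at every point of $\mathcal Q^0$ the Jacobian $\mathbf J_U(\boldsymbol\nu)\in\mathbb R^{\mathcal M\times q}$ has rank $q$, and the second fundamental form has maximal rank, i.e. the components of the second derivatives $\partial_{\nu_j}\partial_{\nu_\ell}U$, $1\le j\le\ell\le q$, orthogonal to the tangent space $\mathrm{Range}(\mathbf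 J_U(\boldsymbol\nu))$ span a space of dimension $\tfrac12q(q+1)$. Sampling. $\boldsymbol\nu^1,\dots,\boldsymbol\nu^M\in\mathcal B(\boldsymbol 0,1)$ are fixed points such that $\mathbf P=[\boldsymbol\nu^1,\dots,\boldsymbol\nu^M]\in\mathbb R^{q\times M}$ has rank $q$. For small $r>0$ the (centered) snapshot matrix is $\mathbf S^r=[\mathbf v_1^r,\dots,\mathbf v_M^r]\in\mathbb R^{\mathcal M\times M}$ with $\mathbf v_i^r=U(r\boldsymbol\nu^i)-\mathbf u^*$. Singular values are ordered decreasingly. Norms and angles. $\|\cdot\|$ on matrices is any sub-multiplicative unitarily invariant norm (e.g. spectral or Frobenius). For two $p$-dimensional subspaces $\mathcal U,\mathcal V$ with orthonormal basis matrices $\mathbf Q_{\mathcal U},\mathbf Q_{\mathcal V}$, the principal angles $\theta_1\le\dots\le\theta_p\in[0,\pi/2]$ are defined by $\cos\theta_i=\sigma_i(\mathbf Q_{\mathcal U}^\top\mathbf Q_{\mathcal V})$ (decreasing singular values), and $\sin\mathbf\Theta(\mathcal U,\mathcal V)=\mathrm{diag}(\sin\theta_1,\dots,\sin\theta_p)$. *)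

theory Defs
  imports "HOL-Analysis.Analysis" "HOL-Library.Landau_Symbols"
begin

section \<open>Differentiability and embedded submanifolds\<close>

text \<open>
  \<open>Ck_on k f S\<close> is meant for open \<open>S\<close>, where the derivative at a point is determined by the
  values of \<open>f\<close> on \<open>S\<close>. A map is of class C^(k+1) iff it is differentiable and
  all its directional derivatives are of class C^k.
\<close>

fun Ck_on :: "nat \<Rightarrow> ('a::real_normed_vector \<Rightarrow> 'b::real_normed_vector) \<Rightarrow> 'a set \<Rightarrow> bool" where
  "Ck_on 0 f S \<longleftrightarrow> continuous_on S f"
| "Ck_on (Suc k) f S \<longleftrightarrow>
     (\<forall>x\<in>S. f differentiable (at x)) \<and>
     (\<forall>h. Ck_on k (\<lambda>x. frechet_derivative f (at x) h) S)"

text \<open>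
  Embedded submanifolds of class C^k and dimension \<open>d\<close>, by slice charts: around each of its
  points the set is carried by an ambient C^k diffeomorphism onto an open piece of a
  \<open>d\<close>-dimensional linear subspace.
\<close>

definition embedded_submanifold :: "nat \<Rightarrow> nat \<Rightarrow> 'a::euclidean_space set \<Rightarrow> bool" where
  "embedded_submanifold k d S \<longleftrightarrow>
     (\<forall>p\<in>S. \<exists>W W' \<Phi> \<Psi> L.
        open W \<and> p \<in> W \<and> open W' \<and> homeomorphism W W' \<Phi> \<Psi> \<and>
        Ck_on k \<Phi> W \<and> Ck_on k \<Psi> W' \<and>
        subspace (L::'a set) \<and> dim L = d \<and> \<Phi> ` (S \<inter> W) = L \<inter> W')"

definition partial_deriv :: "'q \<Rightarrow> (real^'q \<Rightarrow> real^'m) \<Rightarrow> real^'q \<Rightarrow> real^'m" where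
  "partial_deriv j f x = frechet_derivative f (at x) (axis j 1)"

definition normal_component :: "'a::euclidean_space set \<Rightarrow> 'a \<Rightarrow> 'a" where
  "normal_component T w = (THE y. w - y \<in> T \<and> (\<forall>t\<in>T. y \<bullet> t = 0))"

definition full_rank_second_fundamental_form ::
    "(real^'q::{finite,linorder} \<Rightarrow> real^'m) \<Rightarrow> real^'q::{finite,linorder} \<Rightarrow> bool" where
  "full_rank_second_fundamental_form U x \<longleftrightarrow>
     dim (span {normal_component (range (\<lambda>h. jacobian U (at x) *v h))
                  (partial_deriv j (partial_deriv l U) x) | j l. j \<le> l})
       = CARD('q::{finite,linorder}) * (CARD('q) + 1) div 2"

definition inverse_chart ::
    "(real^'m) set \<Rightarrow> real^'m \<Rightarrow> (real^'q) set \<Rightarrow> (real^'q \<Rightarrow> real^'m) \<Rightarrow> bool" where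
  "inverse_chart S p Q U \<longleftrightarrow>
     open Q \<and> ball 0 1 \<subseteq> Q \<and> (\<exists>V. homeomorphism Q (U ` Q) U V) \<and>
     openin (top_of_set S) (U ` Q) \<and> U 0 = p"

definition snapshot_matrix ::
    "(real^'q \<Rightarrow> real^'m) \<Rightarrow> real^'m \<Rightarrow> ('n \<Rightarrow> real^'q) \<Rightarrow> real \<Rightarrow> real^'n^'m" where
  "snapshot_matrix U p \<nu> r = (\<chi> k i. (U (r *\<^sub>R \<nu> i) - p) $ k)"


section \<open>Singular values and principal angles\<close>

text \<open>
  Thin singular value decomposition. Singular values and vectors are indexed from \<open>0\<close>;
  only indices below \<open>min CARD('m) CARD('n)\<close> are meaningful.
\<close>

definition is_svd ::
    "real^'n^'m \<Rightarrow> (nat \<Rightarrow> real^'m) \<Rightarrow> (nat \<Rightarrow> real) \<Rightarrow> (nat \<Rightarrow> real^'n) \<Rightarrow> bool" where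
  "is_svd A u \<sigma> v \<longleftrightarrow>
     (let p = min CARD('m) CARD('n) in
       (\<forall>i<p. \<forall>j<p. u i \<bullet> u j = (if i = j then 1 else 0)) \<and>
       (\<forall>i<p. \<forall>j<p. v i \<bullet> v j = (if i = j then 1 else 0)) \<and>
       (\<forall>i<p. 0 \<le> \<sigma> i) \<and>
       (\<forall>i j. i \<le> j \<and> j < p \<longrightarrow> \<sigma> j \<le> \<sigma> i) \<and>
       A = (\<Sum>i<p. \<sigma> i *\<^sub>R (\<chi> a b. u i $ a * v i $ b)))"

text \<open>
  The values \<open>\<sigma> i\<close> with \<open>i < min CARD('m) CARD('n)\<close> are the same in every decomposition of \<open>A\<close>,
  so the choice is immaterial.
\<close>

definition singular_value :: "real^'n^'m \<Rightarrow> nat \<Rightarrow> real" where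
  "singular_value A = (SOME \<sigma>. \<exists>u v. is_svd A u \<sigma> v)"

definition orthonormal_basis_matrix :: "real^'p^'m \<Rightarrow> (real^'m) set \<Rightarrow> bool" where
  "orthonormal_basis_matrix Q \<U> \<longleftrightarrow> transpose Q ** Q = mat 1 \<and> span (columns Q) = \<U>"

text \<open>
  Principal angles between two subspaces of dimension \<open>CARD('p)\<close>, increasing in the
  index. The linear order on \<open>'p\<close> identifies it with \<open>{0..<CARD('p)}\<close>, the element \<open>i\<close>
  being the one of rank \<open>card {..<i}\<close>. The singular values used do not depend on the
  chosen orthonormal bases.
\<close>

definition principal_angles ::
    "(real^'m) set \<Rightarrow> (real^'m) set \<Rightarrow> real^'p::{finite,linorder}" where
  "principal_angles \<U> \<V> =
     (let Q = (SOME Q :: real^'p::{finite,linorder}^'m. orthonormal_basis_matrix Q \<U>);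
          R = (SOME R :: real^'p::{finite,linorder}^'m. orthonormal_basis_matrix R \<V>)
      in \<chi> i. arccos (singular_value (transpose Q ** R) (card {..<i})))"

definition sin_Theta ::
    "(real^'m) set \<Rightarrow> (real^'m) set \<Rightarrow> real^'p::{finite,linorder}^'p::{finite,linorder}" where
  "sin_Theta \<U> \<V> = (\<chi> i j. if i = j then sin (principal_angles \<U> \<V> $ i) else 0)"

definition submult_unitarily_invariant_norm :: "(real^'p^'p \<Rightarrow> real) \<Rightarrow> bool" where
  "submult_unitarily_invariant_norm N \<longleftrightarrow>
     (\<forall>A. N A = 0 \<longleftrightarrow> A = 0) \<and>
     (\<forall>c A. N (c *\<^sub>R A) = \<bar>c\<bar> * N A) \<and>
     (\<forall>A B. N (A + B) \<le> N A + N B) \<and>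
     (\<forall>A B. N (A ** B) \<le> N A * N B) \<and>
     (\<forall>A W V. orthogonal_matrix W \<and> orthogonal_matrix V \<longrightarrow> N (W ** A ** V) = N A)"

end

theory Submission
  imports Defs
begin

text \<open>
  Let \<open>J\<close> be the Jacobian of \<open>U\<close> at \<open>0\<close> and \<open>P\<close> the matrix of sample points. Taylor expansion of each
  column gives \<open>S\<^sup>r = r J P + E\<close> with an error \<open>E\<close> of size \<open>O(r\<^sup>2)\<close> (\<open>snapshot_matrix_linearization\<close>).
  The range of \<open>J P\<close> lies in the tangent space, and \<open>J P\<close> is bounded below by some \<open>c > 0\<close> on the
  \<open>q\<close>-dimensional row space of \<open>P\<close>, since \<open>J\<close> is injective and \<open>P\<close> has rank \<open>q\<close>
  (\<open>bounded_below_on_row_space\<close>). By the Courant-Fischer principle the first \<open>q\<close> singular values of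
  \<open>S\<^sup>r\<close> are therefore at least \<open>r c - O(r\<^sup>2)\<close> (\<open>singular_value_lower_bound\<close>).

  The signal is of order \<open>r\<close> and the noise of order \<open>r\<^sup>2\<close>, and the rate \<open>O(r)\<close> is their quotient: a unit
  vector in the span of the leading left singular vectors is \<open>S\<^sup>r y\<close> with \<open>\<bar>y\<bar> = O(1/r)\<close>, so that it is within
  \<open>\<bar>E y\<bar> = O(r)\<close> of the tangent vector \<open>r J P y\<close> (\<open>leading_singular_subspace_near_range\<close>). The sine of each
  principal angle is the distance to the tangent space of one such unit vector
  (\<open>sin_principal_angle_le\<close>), and any norm of a diagonal matrix is bounded by a multiple of its
  largest entry (\<open>norm_sin_Theta_bounded\<close>).

  Since principal angles are defined through a chosen singular value decomposition, its existence is
  proved as well, by successively maximising the norm of \<open>A x\<close> over unit vectors \<open>x\<close> orthogonal to the previous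
  right singular vectors (\<open>svd_exists\<close>).
\<close>

section \<open>Orthonormal families\<close>

definition orthonormal_upto :: "nat \<Rightarrow> (nat \<Rightarrow> 'a::real_inner) \<Rightarrow> bool" where
  "orthonormal_upto n e \<longleftrightarrow> (\<forall>i<n. \<forall>j<n. e i \<bullet> e j = (if i = j then 1 else 0))"

lemma orthonormal_uptoD:
  "orthonormal_upto n e \<Longrightarrow> i < n \<Longrightarrow> j < n \<Longrightarrow> e i \<bullet> e j = (if i = j then 1 else 0)"
  by (auto simp: orthonormal_upto_def)

lemma orthonormal_upto_norm: "orthonormal_upto n e \<Longrightarrow> i < n \<Longrightarrow> norm (e i) = 1"
  by (simp add: norm_eq_1 orthonormal_uptoD)

lemma orthonormal_upto_mono: "orthonormal_upto n e \<Longrightarrow> m \<le> n \<Longrightarrow> orthonormal_upto m e"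
  by (auto simp: orthonormal_upto_def)

lemma orthonormal_upto_extend:
  assumes "orthonormal_upto n e" "norm x = 1" "\<forall>i<n. e i \<bullet> x = 0"
  shows "orthonormal_upto (Suc n) (e(n := x))"
  using assms by (auto simp: orthonormal_upto_def less_Suc_eq norm_eq_1 inner_commute)

lemma inner_sum_orthonormal:
  assumes "orthonormal_upto n e" "j < n"
  shows "(\<Sum>i<n. a i *\<^sub>R e i) \<bullet> e j = a j"
proof -
  have "(\<Sum>i<n. a i *\<^sub>R e i) \<bullet> e j = (\<Sum>i<n. a i * (if i = j then 1 else 0))"
    using assms by (simp add: inner_sum_left orthonormal_uptoD)
  also have "\<dots> = (\<Sum>i<n. if i = j then a i else 0)"
    by (intro sum.cong) auto
  finally show ?thesis using assms(2) by simp
qed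

lemma norm_sum_orthonormal:
  assumes "orthonormal_upto n e"
  shows "(norm (\<Sum>i<n. a i *\<^sub>R e i))\<^sup>2 = (\<Sum>i<n. (a i)\<^sup>2)"
proof -
  have "(norm (\<Sum>i<n. a i *\<^sub>R e i))\<^sup>2 = (\<Sum>j<n. a j * ((\<Sum>i<n. a i *\<^sub>R e i) \<bullet> e j))"
    by (simp only: power2_norm_eq_inner inner_sum_right inner_scaleR_right)
  then show ?thesis using assms by (simp add: inner_sum_orthonormal power2_eq_square)
qed

lemma bessel_inequality:
  assumes "orthonormal_upto n e"
  shows "(\<Sum>i<n. (e i \<bullet> x)\<^sup>2) \<le> (norm x)\<^sup>2"
proof -
  let ?y = "\<Sum>i<n. (e i \<bullet> x) *\<^sub>R e i"
  have yy: "?y \<bullet> ?y = (\<Sum>i<n. (e i \<bullet> x)\<^sup>2)"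
    using norm_sum_orthonormal[OF assms] by (simp add: power2_norm_eq_inner)
  have yx: "?y \<bullet> x = (\<Sum>i<n. (e i \<bullet> x)\<^sup>2)"
    by (simp add: inner_sum_left power2_eq_square)
  have "0 \<le> (x - ?y) \<bullet> (x - ?y)" by simp
  also have "\<dots> = x \<bullet> x - ?y \<bullet> x"
    using yy yx by (simp add: inner_diff_left inner_diff_right inner_commute)
  finally show ?thesis using yx by (simp add: power2_norm_eq_inner)
qed

lemma dim_span_orthonormal:
  fixes e :: "nat \<Rightarrow> 'a::euclidean_space"
  assumes "orthonormal_upto n e"
  shows "dim (span (e ` {..<n})) = n"
proof -
  have ne: "e i \<noteq> e j" if "i < n" "j < n" "i \<noteq> j" for i j
    using orthonormal_uptoD[OF assms, of i j] orthonormal_uptoD[OF assms, of i i] that by auto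
  have "inj_on e {..<n}" using ne by (auto simp: inj_on_def)
  moreover have "independent (e ` {..<n})"
  proof (rule pairwise_orthogonal_independent)
    show "pairwise orthogonal (e ` {..<n})"
      using assms by (auto simp: pairwise_def orthogonal_def orthonormal_upto_def)
    show "0 \<notin> e ` {..<n}"
      using orthonormal_upto_norm[OF assms] by force
  qed
  ultimately show ?thesis by (simp add: dim_eq_card_independent card_image)
qed

lemma unit_vector_orthogonal_to_family:
  fixes e :: "nat \<Rightarrow> 'a::euclidean_space"
  assumes "n < DIM('a)"
  obtains x where "norm x = 1" "\<forall>i<n. e i \<bullet> x = 0"
proof -
  have "dim (e ` {..<n}) \<le> card (e ` {..<n})" by (simp add: dim_le_card')
  also have "\<dots> \<le> n" using card_image_le[of "{..<n}" e] by simp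
  finally obtain x where x: "x \<noteq> 0" "\<And>y. y \<in> span (e ` {..<n}) \<Longrightarrow> orthogonal x y"
    using orthogonal_to_subspace_exists[of "e ` {..<n}"] assms by (metis le_less_trans)
  show thesis
  proof
    show "norm (sgn x) = 1" using x(1) by (simp add: norm_sgn)
    show "\<forall>i<n. e i \<bullet> sgn x = 0"
      using x(2)[OF span_base[OF imageI]] by (simp add: orthogonal_def inner_commute sgn_div_norm)
  qed
qed

lemma orthonormal_expansion:
  fixes e :: "nat \<Rightarrow> 'a::euclidean_space"
  assumes e: "orthonormal_upto n e" and x: "x \<in> span (e ` {..<n})"
  shows "(\<Sum>i<n. (e i \<bullet> x) *\<^sub>R e i) = x"
proof -
  let ?y = "x - (\<Sum>i<n. (e i \<bullet> x) *\<^sub>R e i)"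
  have "?y \<in> span (e ` {..<n})"
    using x by (intro span_diff span_sum span_scale) (auto intro: span_base)
  moreover have "orthogonal ?y z" if "z \<in> e ` {..<n}" for z
    using that inner_sum_orthonormal[OF e, of _ "\<lambda>i. e i \<bullet> x"]
    by (auto simp: orthogonal_def inner_diff_left inner_commute[of x])
  ultimately have "orthogonal ?y ?y"
    using orthogonal_to_span by blast
  then show ?thesis by (simp add: orthogonal_def)
qed

lemma orthonormal_expansion_full:
  fixes e :: "nat \<Rightarrow> 'a::euclidean_space"
  assumes "orthonormal_upto DIM('a) e"
  shows "(\<Sum>i<DIM('a). (e i \<bullet> x) *\<^sub>R e i) = x"
proof (rule orthonormal_expansion[OF assms])
  have "span (e ` {..<DIM('a)}) = UNIV"
    using dim_span_orthonormal[OF assms] by (metis dim_eq_full span_span)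
  then show "x \<in> span (e ` {..<DIM('a)})" by simp
qed

section \<open>Singular value decompositions\<close>

text \<open>
  The first-order condition at a maximum: a linear term dominated by a quadratic one, with either
  sign of the variable, has to vanish.
\<close>

lemma linear_term_dominated_imp_zero:
  fixes b c :: real
  assumes ineq: "\<And>t. 2 * t * b \<le> t\<^sup>2 * c" and "c \<ge> 0"
  shows "b = 0"
proof -
  have "2 * (b / (c + 1)) * b \<le> (b / (c + 1))\<^sup>2 * c" by (rule ineq)
  also have "\<dots> \<le> (b / (c + 1))\<^sup>2 * (c + 1)" by (intro mult_left_mono) auto
  also have "\<dots> = (b / (c + 1)) * b"
    using \<open>c \<ge> 0\<close> by (simp add: power2_eq_square)
  finally have "b\<^sup>2 / (c + 1) \<le> 0" by (simp add: power2_eq_square)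
  then show ?thesis using \<open>c \<ge> 0\<close> by (simp add: divide_le_0_iff)
qed

text \<open>
  The next singular pair comes from a maximiser \<open>x\<close> of the norm of \<open>A x\<close> on the unit sphere of the
  orthogonal complement of the right vectors found so far: \<open>s\<close> is the maximum and \<open>y\<close> the
  normalised image. Optimality makes \<open>A x\<close> orthogonal to \<open>A z\<close> for all \<open>z\<close> of that complement
  orthogonal to \<open>x\<close>, which is what turns \<open>x\<close> into an image of \<open>y\<close> under the transpose. That in turn
  keeps the next left vector orthogonal to \<open>y\<close>. If the maximum is \<open>0\<close>, any unit vector orthogonal to
  the earlier left vectors serves as \<open>y\<close>; this is where the matrix must not have more columns than
  rows.
\<close>

lemma greedy_svd_step:
  fixes A :: "real^'n^'m"
  assumes k: "k < CARD('n)" and nm: "CARD('n) \<le> CARD('m)"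
    and u: "orthonormal_upto k u" and v: "orthonormal_upto k v"
    and Av: "\<forall>i<k. A *v v i = \<sigma> i *\<^sub>R u i" and Au: "\<forall>i<k. u i v* A = \<sigma> i *\<^sub>R v i"
  obtains x y s where "norm x = 1" "norm y = 1" "s \<ge> 0"
    "\<forall>i<k. v i \<bullet> x = 0" "\<forall>i<k. u i \<bullet> y = 0" "A *v x = s *\<^sub>R y" "y v* A = s *\<^sub>R x"
    "\<And>z. \<forall>i<k. v i \<bullet> z = 0 \<Longrightarrow> norm (A *v z) \<le> s * norm z"
proof -
  define W where "W = {z. \<forall>i<k. v i \<bullet> z = 0}"
  have W_eq: "W = (\<Inter>i<k. {z. v i \<bullet> z = 0})" by (auto simp: W_def)
  have "closed W" unfolding W_eq by (intro closed_INT ballI closed_hyperplane)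
  then have "compact (sphere 0 1 \<inter> W)" by (simp add: compact_Int_closed)
  moreover have "sphere 0 1 \<inter> W \<noteq> {}"
  proof -
    have "k < DIM(real^'n)" using k by simp
    then obtain z where "norm z = 1" "\<forall>i<k. v i \<bullet> z = 0"
      by (rule unit_vector_orthogonal_to_family)
    then have "z \<in> sphere 0 1 \<inter> W" by (simp add: W_def)
    then show ?thesis by blast
  qed
  moreover have "continuous_on (sphere 0 1 \<inter> W) (\<lambda>z. norm (A *v z))"
    by (intro continuous_on_norm linear_continuous_on matrix_vector_mul_bounded_linear)
  ultimately obtain x where x: "x \<in> sphere 0 1 \<inter> W"
    and max: "\<forall>z\<in>sphere 0 1 \<inter> W. norm (A *v z) \<le> norm (A *v x)"
    using continuous_attains_sup[of "sphere 0 1 \<inter> W" "\<lambda>z. norm (A *v z)"] by blast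
  define s where "s = norm (A *v x)"
  have nx: "norm x = 1" and xW: "\<forall>i<k. v i \<bullet> x = 0" using x by (auto simp: W_def)
  have bound: "norm (A *v z) \<le> s * norm z" if "\<forall>i<k. v i \<bullet> z = 0" for z
  proof (cases "z = 0")
    case False
    have "norm (A *v sgn z) \<le> s"
      unfolding s_def using that False
      by (intro max[rule_format]) (auto simp: W_def norm_sgn sgn_div_norm)
    then show ?thesis using False
      by (simp add: sgn_div_norm matrix_vector_mult_scaleR field_simps)
  qed simp
  \<comment> \<open>Compare the value at \<open>x\<close> with the values along the line \<open>x + t z\<close>.\<close>
  have opt: "(A *v x) \<bullet> (A *v z) = 0" if z: "\<forall>i<k. v i \<bullet> z = 0" and xz: "x \<bullet> z = 0" for z
  proof -
    let ?b = "(A *v x) \<bullet> (A *v z)" and ?c = "s\<^sup>2 * (norm z)\<^sup>2"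
    have ineq: "2 * t * ?b \<le> t\<^sup>2 * ?c" for t :: real
    proof -
      have "norm (A *v (x + t *\<^sub>R z)) \<le> s * norm (x + t *\<^sub>R z)"
        using z xW by (intro bound) (auto simp: inner_add_right)
      then have "(norm (A *v (x + t *\<^sub>R z)))\<^sup>2 \<le> s\<^sup>2 * (norm (x + t *\<^sub>R z))\<^sup>2"
        by (metis norm_ge_zero power_mono power_mult_distrib)
      moreover have "(norm (A *v (x + t *\<^sub>R z)))\<^sup>2 = s\<^sup>2 + 2 * t * ?b + t\<^sup>2 * (norm (A *v z))\<^sup>2"
        unfolding s_def power2_norm_eq_inner
        by (simp add: matrix_vector_right_distrib matrix_vector_mult_scaleR inner_add_left
            inner_add_right inner_commute power2_eq_square algebra_simps)
      moreover have "(norm (x + t *\<^sub>R z))\<^sup>2 = 1 + t\<^sup>2 * (norm z)\<^sup>2"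
        unfolding power2_norm_eq_inner using nx xz
        by (simp add: inner_add_left inner_add_right inner_commute power2_eq_square norm_eq_1)
      ultimately have "s\<^sup>2 + 2 * t * ?b + t\<^sup>2 * (norm (A *v z))\<^sup>2 \<le> s\<^sup>2 * (1 + t\<^sup>2 * (norm z)\<^sup>2)"
        by (simp only:)
      then have "2 * t * ?b + t\<^sup>2 * (norm (A *v z))\<^sup>2 \<le> t\<^sup>2 * ?c"
        by (simp add: algebra_simps)
      moreover have "0 \<le> t\<^sup>2 * (norm (A *v z))\<^sup>2" by simp
      ultimately show ?thesis by linarith
    qed
    show ?thesis
      using ineq by (intro linear_term_dominated_imp_zero[of ?b ?c]) auto
  qed
  have Ax_u: "u i \<bullet> (A *v x) = 0" if "i < k" for i
    using that Au xW dot_lmul_matrix[of "u i" A x] by simp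
  obtain y where y: "norm y = 1" "\<forall>i<k. u i \<bullet> y = 0" "A *v x = s *\<^sub>R y"
  proof (cases "s = 0")
    case True
    obtain y where "norm y = 1" "\<forall>i<k. u i \<bullet> y = 0"
      using unit_vector_orthogonal_to_family[of k u] k nm by auto
    then show thesis using True by (intro that[of y]) (auto simp: s_def)
  next
    case False
    then show thesis
      by (intro that[of "(1 / s) *\<^sub>R (A *v x)"]) (auto simp: Ax_u s_def)
  qed
  \<comment> \<open>Test against \<open>z\<close>, split into its parts along the earlier right vectors, along \<open>x\<close>, and a rest \<open>w\<close>.\<close>
  have "y v* A = s *\<^sub>R x"
  proof (rule vector_eq_rdot[THEN iffD1], rule allI)
    fix z
    define w where "w = z - (\<Sum>i<k. (v i \<bullet> z) *\<^sub>R v i) - (x \<bullet> z) *\<^sub>R x"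
    have wv: "\<forall>i<k. v i \<bullet> w = 0"
      using inner_sum_orthonormal[OF v] xW
      by (auto simp: w_def inner_diff_right inner_commute)
    have wx: "x \<bullet> w = 0"
      using xW nx by (simp add: w_def inner_diff_right inner_sum_right norm_eq_1 inner_commute)
    have "y \<bullet> (A *v w) = 0"
    proof (cases "s = 0")
      case True then show ?thesis using bound[OF wv] by simp
    next
      case False then show ?thesis using opt[OF wv wx] y(3) by simp
    qed
    moreover have "z = w + (\<Sum>i<k. (v i \<bullet> z) *\<^sub>R v i) + (x \<bullet> z) *\<^sub>R x" by (simp add: w_def)
    then have "A *v z = A *v w + (\<Sum>i<k. (v i \<bullet> z) *\<^sub>R (A *v v i)) + (x \<bullet> z) *\<^sub>R (A *v x)"
      by (metis (no_types, lifting) linear_sum matrix_vector_mul_linear matrix_vector_mult_scaleR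
          matrix_vector_right_distrib sum.cong)
    ultimately have "y \<bullet> (A *v z) = s * (x \<bullet> z)"
      using y Av by (simp add: inner_add_right inner_sum_right norm_eq_1 inner_commute)
    then show "(y v* A) \<bullet> z = (s *\<^sub>R x) \<bullet> z"
      by (simp add: dot_lmul_matrix)
  qed
  moreover have "s \<ge> 0" by (simp add: s_def)
  ultimately show thesis using nx y xW bound that by blast
qed

text \<open>
  The last conjunct is the invariant that makes the singular values decrease: a later right vector
  competes in the earlier maximisation problems.
\<close>

lemma greedy_svd:
  fixes A :: "real^'n^'m"
  assumes nm: "CARD('n) \<le> CARD('m)" and "k \<le> CARD('n)"
  shows "\<exists>u \<sigma> v. orthonormal_upto k u \<and> orthonormal_upto k v \<and>
    (\<forall>i<k. A *v v i = \<sigma> i *\<^sub>R u i) \<and> (\<forall>i<k. u i v* A = \<sigma> i *\<^sub>R v i) \<and>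
    (\<forall>i<k. 0 \<le> \<sigma> i) \<and> (\<forall>i j. i \<le> j \<and> j < k \<longrightarrow> \<sigma> j \<le> \<sigma> i) \<and>
    (\<forall>i<k. \<forall>z. (\<forall>i<k. v i \<bullet> z = 0) \<longrightarrow> norm (A *v z) \<le> \<sigma> i * norm z)"
  using assms(2)
proof (induction k)
  case 0 then show ?case by (simp add: orthonormal_upto_def)
next
  case (Suc k)
  then obtain u \<sigma> v where u: "orthonormal_upto k u" and v: "orthonormal_upto k v"
    and Av: "\<forall>i<k. A *v v i = \<sigma> i *\<^sub>R u i" and Au: "\<forall>i<k. u i v* A = \<sigma> i *\<^sub>R v i"
    and pos: "\<forall>i<k. 0 \<le> \<sigma> i" and dec: "\<forall>i j. i \<le> j \<and> j < k \<longrightarrow> \<sigma> j \<le> \<sigma> i"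
    and opt: "\<forall>i<k. \<forall>z. (\<forall>i<k. v i \<bullet> z = 0) \<longrightarrow> norm (A *v z) \<le> \<sigma> i * norm z"
    by auto
  obtain x y s where xy: "norm x = 1" "norm y = 1" "s \<ge> 0"
    "\<forall>i<k. v i \<bullet> x = 0" "\<forall>i<k. u i \<bullet> y = 0" "A *v x = s *\<^sub>R y" "y v* A = s *\<^sub>R x"
    and bd: "\<And>z. \<forall>i<k. v i \<bullet> z = 0 \<Longrightarrow> norm (A *v z) \<le> s * norm z"
    using greedy_svd_step[OF _ nm u v Av Au] Suc.prems by (metis Suc_le_eq)
  have s_le: "s \<le> \<sigma> i" if "i < k" for i
    using opt[rule_format, OF that, of x] xy by simp
  let ?\<sigma> = "\<sigma>(k := s)"
  have "orthonormal_upto (Suc k) (u(k := y))" "orthonormal_upto (Suc k) (v(k := x))"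
    using xy u v by (auto intro: orthonormal_upto_extend)
  moreover have "\<forall>i<Suc k. A *v (v(k := x)) i = ?\<sigma> i *\<^sub>R (u(k := y)) i"
    "\<forall>i<Suc k. (u(k := y)) i v* A = ?\<sigma> i *\<^sub>R (v(k := x)) i" "\<forall>i<Suc k. 0 \<le> ?\<sigma> i"
    using Av Au xy pos by (auto simp: less_Suc_eq)
  moreover have "\<forall>i j. i \<le> j \<and> j < Suc k \<longrightarrow> ?\<sigma> j \<le> ?\<sigma> i"
    using dec s_le by (auto simp: less_Suc_eq)
  moreover have "norm (A *v z) \<le> ?\<sigma> i * norm z"
    if "i < Suc k" and z: "\<forall>i<Suc k. (v(k := x)) i \<bullet> z = 0" for i z
  proof -
    have z': "v j \<bullet> z = 0" if "j < k" for j using z that by (auto dest: spec[of _ j])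
    show ?thesis using that(1) bd[of z] opt z' by (auto simp: less_Suc_eq)
  qed
  ultimately show ?case by blast
qed

lemma outer_product_sum_mult:
  fixes u :: "'i \<Rightarrow> real^'m" and v :: "'i \<Rightarrow> real^'n"
  shows "(\<Sum>i\<in>I. \<sigma> i *\<^sub>R (\<chi> a b. u i $ a * v i $ b)) *v x = (\<Sum>i\<in>I. (\<sigma> i * (v i \<bullet> x)) *\<^sub>R u i)"
proof -
  have "(\<Sum>b\<in>UNIV. (\<Sum>i\<in>I. \<sigma> i * (u i $ a * v i $ b)) * x $ b)
      = (\<Sum>i\<in>I. \<sigma> i * (\<Sum>b\<in>UNIV. v i $ b * x $ b) * u i $ a)" for a
    unfolding sum_distrib_left sum_distrib_right
    by (subst sum.swap) (simp add: mult_ac)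
  then show ?thesis
    by (simp add: vec_eq_iff matrix_vector_mult_def inner_vec_def)
qed

text \<open>
  Singular values are chosen by Hilbert's operator, so facts about them, and hence about
  principal angles, rest on this existence result.
\<close>

lemma svd_exists:
  fixes A :: "real^'n^'m"
  assumes "CARD('n) \<le> CARD('m)"
  shows "\<exists>u \<sigma> v. is_svd A u \<sigma> v"
proof -
  let ?n = "CARD('n)"
  obtain u \<sigma> v where u: "orthonormal_upto ?n u" and v: "orthonormal_upto ?n v"
    and Av: "\<forall>i<?n. A *v v i = \<sigma> i *\<^sub>R u i"
    and pos: "\<forall>i<?n. 0 \<le> \<sigma> i" and dec: "\<forall>i j. i \<le> j \<and> j < ?n \<longrightarrow> \<sigma> j \<le> \<sigma> i"
    using greedy_svd[OF assms order_refl, of A] by auto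
  have "A = (\<Sum>i<?n. \<sigma> i *\<^sub>R (\<chi> a b. u i $ a * v i $ b))" (is "A = ?S")
  proof (rule matrix_eq[THEN iffD2], rule allI)
    fix x
    have ex: "(\<Sum>i<?n. (v i \<bullet> x) *\<^sub>R v i) = x"
      using orthonormal_expansion_full[of v x] v by simp
    have "A *v x = A *v (\<Sum>i<?n. (v i \<bullet> x) *\<^sub>R v i)"
      by (simp only: ex)
    also have "\<dots> = (\<Sum>i<?n. (v i \<bullet> x) *\<^sub>R (A *v v i))"
      by (simp add: linear_sum[OF matrix_vector_mul_linear] matrix_vector_mult_scaleR)
    also have "\<dots> = (\<Sum>i<?n. (\<sigma> i * (v i \<bullet> x)) *\<^sub>R u i)"
      using Av by (intro sum.cong) auto
    also have "\<dots> = ?S *v x" by (simp add: outer_product_sum_mult)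
    finally show "A *v x = ?S *v x" .
  qed
  then have "is_svd A u \<sigma> v"
    using u v pos dec assms by (simp add: is_svd_def orthonormal_upto_def min_absorb2)
  then show ?thesis by blast
qed

lemma is_svd_orthonormal:
  fixes A :: "real^'n^'m"
  assumes "is_svd A u \<sigma> v"
  shows "orthonormal_upto (min CARD('m) CARD('n)) u" "orthonormal_upto (min CARD('m) CARD('n)) v"
  using assms unfolding is_svd_def orthonormal_upto_def Let_def by blast+

lemma is_svd_mult:
  fixes A :: "real^'n^'m"
  assumes "is_svd A u \<sigma> v"
  shows "A *v x = (\<Sum>i<min CARD('m) CARD('n). (\<sigma> i * (v i \<bullet> x)) *\<^sub>R u i)"
proof -
  have "A = (\<Sum>i<min CARD('m) CARD('n). \<sigma> i *\<^sub>R (\<chi> a b. u i $ a * v i $ b))"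
    using assms unfolding is_svd_def Let_def by blast
  from arg_cong[OF this, of "\<lambda>M. M *v x"] show ?thesis
    unfolding outer_product_sum_mult .
qed

lemma is_svd_right_vector:
  fixes A :: "real^'n^'m"
  assumes "is_svd A u \<sigma> v" "i < min CARD('m) CARD('n)"
  shows "A *v v i = \<sigma> i *\<^sub>R u i"
proof -
  let ?p = "min CARD('m) CARD('n)"
  have "A *v v i = (\<Sum>j<?p. (\<sigma> j * (v j \<bullet> v i)) *\<^sub>R u j)" by (rule is_svd_mult[OF assms(1)])
  also have "\<dots> = (\<Sum>j<?p. if j = i then \<sigma> i *\<^sub>R u i else 0)"
    using orthonormal_uptoD[OF is_svd_orthonormal(2)[OF assms(1)]] assms(2)
    by (intro sum.cong) auto
  finally show ?thesis using assms(2) by simp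
qed

lemma is_svd_left_vector:
  fixes A :: "real^'n^'m"
  assumes "is_svd A u \<sigma> v" "i < min CARD('m) CARD('n)"
  shows "u i v* A = \<sigma> i *\<^sub>R v i"
proof (rule vector_eq_rdot[THEN iffD1], rule allI)
  fix x
  have "(u i v* A) \<bullet> x = (A *v x) \<bullet> u i" by (metis dot_lmul_matrix inner_commute)
  also have "A *v x = (\<Sum>j<min CARD('m) CARD('n). (\<sigma> j * (v j \<bullet> x)) *\<^sub>R u j)"
    by (rule is_svd_mult[OF assms(1)])
  also have "\<dots> \<bullet> u i = \<sigma> i * (v i \<bullet> x)"
    by (rule inner_sum_orthonormal[OF is_svd_orthonormal(1)[OF assms(1)] assms(2)])
  finally show "(u i v* A) \<bullet> x = (\<sigma> i *\<^sub>R v i) \<bullet> x" by simp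
qed

lemma subspace_vector_orthogonal_to_family:
  fixes W :: "'a::euclidean_space set"
  assumes W: "subspace W" and i: "i < dim W"
  obtains x where "x \<in> W" "x \<noteq> 0" "\<forall>j<i. v j \<bullet> x = 0"
proof -
  define V where "V = span (v ` {..<i})"
  define V' where "V' = {y \<in> UNIV. \<forall>x\<in>V. orthogonal x y}"
  have "dim V \<le> card (v ` {..<i})" unfolding V_def by (simp add: dim_le_card')
  also have "\<dots> \<le> i" using card_image_le[of "{..<i}" v] by simp
  finally have dV: "dim V \<le> i" .
  have "dim V' + dim V = DIM('a)"
    unfolding V'_def V_def
    using dim_subspace_orthogonal_to_vectors[of "span (v ` {..<i})" UNIV] by simp
  moreover have sV': "subspace V'"
    by (auto simp: subspace_def V'_def orthogonal_def inner_add_right)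
  have "dim {x + y |x y. x \<in> W \<and> y \<in> V'} + dim (W \<inter> V') = dim W + dim V'"
    by (rule dim_sums_Int[OF W sV'])
  moreover have "dim {x + y |x y. x \<in> W \<and> y \<in> V'} \<le> DIM('a)" by (rule dim_subset_UNIV)
  ultimately have "dim (W \<inter> V') > 0" using dV i by linarith
  then have "\<not> W \<inter> V' \<subseteq> {0}" by (metis dim_eq_0 less_irrefl)
  then obtain x where "x \<in> W" "x \<in> V'" "x \<noteq> 0" by blast
  moreover from this have "\<forall>j<i. v j \<bullet> x = 0"
    by (auto simp: V'_def V_def orthogonal_def intro: span_base)
  ultimately show thesis using that by blast
qed

text \<open>
  One half of the Courant-Fischer principle. A dimension count gives a nonzero \<open>x\<close> in \<open>W\<close> orthogonal
  to the right vectors of index below \<open>i\<close>; on such an \<open>x\<close> the matrix stretches by at most \<open>\<sigma> i\<close>.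
\<close>

lemma singular_value_lower_bound:
  fixes A :: "real^'n^'m"
  assumes svd: "is_svd A u \<sigma> v" and W: "subspace W"
    and lower: "\<And>x. x \<in> W \<Longrightarrow> c * norm x \<le> norm (A *v x)"
    and i: "i < dim W" "i < min CARD('m) CARD('n)"
  shows "c \<le> \<sigma> i"
proof -
  let ?p = "min CARD('m) CARD('n)"
  note u = is_svd_orthonormal(1)[OF svd] and v = is_svd_orthonormal(2)[OF svd]
  have pos: "\<forall>j<?p. 0 \<le> \<sigma> j" and dec: "\<And>j. i \<le> j \<Longrightarrow> j < ?p \<Longrightarrow> \<sigma> j \<le> \<sigma> i"
    using svd unfolding is_svd_def Let_def by blast+
  obtain x where x: "x \<in> W" "x \<noteq> 0" "\<forall>j<i. v j \<bullet> x = 0"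
    using subspace_vector_orthogonal_to_family[OF W i(1)] by blast
  have "(norm (A *v x))\<^sup>2 = (\<Sum>j<?p. (\<sigma> j * (v j \<bullet> x))\<^sup>2)"
    unfolding is_svd_mult[OF svd] by (rule norm_sum_orthonormal[OF u])
  also have "\<dots> \<le> (\<Sum>j<?p. (\<sigma> i)\<^sup>2 * (v j \<bullet> x)\<^sup>2)"
  proof (intro sum_mono)
    fix j assume j: "j \<in> {..<?p}"
    show "(\<sigma> j * (v j \<bullet> x))\<^sup>2 \<le> (\<sigma> i)\<^sup>2 * (v j \<bullet> x)\<^sup>2"
    proof (cases "j < i")
      case False
      then have "(\<sigma> j)\<^sup>2 \<le> (\<sigma> i)\<^sup>2" using j pos dec[of j] by (intro power_mono) auto
      then show ?thesis by (simp add: power_mult_distrib mult_right_mono)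
    qed (use x(3) in simp)
  qed
  also have "\<dots> \<le> (\<sigma> i)\<^sup>2 * (norm x)\<^sup>2"
    unfolding sum_distrib_left[symmetric] by (intro mult_left_mono bessel_inequality v) simp
  finally have "(norm (A *v x))\<^sup>2 \<le> (\<sigma> i * norm x)\<^sup>2" by (simp add: power_mult_distrib)
  moreover have "0 \<le> \<sigma> i * norm x" using pos i(2) by simp
  ultimately have "norm (A *v x) \<le> \<sigma> i * norm x" by (rule power2_le_imp_le)
  then have "c * norm x \<le> \<sigma> i * norm x" using lower[OF x(1)] by linarith
  then show ?thesis using x(2) by simp
qed

text \<open>
  A one-sided substitute for Wedin's theorem. By the lower bound above, perturbing \<open>B\<close> by \<open>e\<close> leaves the
  first \<open>q\<close> singular values at least \<open>c - e\<close>. Hence every unit vector \<open>x\<close> spanned by the leading left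
  vectors is \<open>A y\<close> for some \<open>y\<close> of norm at most \<open>1 / (c - e)\<close>, and \<open>B y\<close> differs from \<open>A y\<close> by at most
  \<open>e\<close> times that norm.
\<close>

lemma leading_singular_subspace_near_range:
  fixes A B :: "real^'n^'m"
  assumes svd: "is_svd A u \<sigma> v" and W: "subspace W" and dimW: "dim W = q"
    and q: "q \<le> min CARD('m) CARD('n)"
    and lower: "\<And>x. x \<in> W \<Longrightarrow> c * norm x \<le> norm (B *v x)"
    and close: "\<And>x. norm (A *v x - B *v x) \<le> e * norm x" and ec: "0 \<le> e" "e < c"
    and x: "x \<in> span (u ` {..<q})" "norm x = 1"
  shows "\<exists>y. norm (x - B *v y) \<le> e / (c - e)"
proof -
  have u: "orthonormal_upto q u" and v: "orthonormal_upto q v"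
    using is_svd_orthonormal[OF svd] q by (auto intro: orthonormal_upto_mono)
  have lowerA: "(c - e) * norm z \<le> norm (A *v z)" if "z \<in> W" for z
    using lower[OF that] close[of z] norm_triangle_ineq2[of "B *v z" "A *v z"]
    by (simp add: norm_minus_commute algebra_simps)
  have \<sigma>: "c - e \<le> \<sigma> i" if "i < q" for i
    using singular_value_lower_bound[OF svd W lowerA] that dimW q by simp
  \<comment> \<open>The preimage of \<open>x\<close> under the pseudo-inverse of \<open>A\<close>.\<close>
  define y where "y = (\<Sum>i<q. ((u i \<bullet> x) / \<sigma> i) *\<^sub>R v i)"
  have "A *v y = (\<Sum>i<q. ((u i \<bullet> x) / \<sigma> i) *\<^sub>R (A *v v i))"
    by (simp add: y_def linear_sum[OF matrix_vector_mul_linear] matrix_vector_mult_scaleR)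
  also have "\<dots> = (\<Sum>i<q. (u i \<bullet> x) *\<^sub>R u i)"
  proof (intro sum.cong refl)
    fix i assume "i \<in> {..<q}"
    then show "((u i \<bullet> x) / \<sigma> i) *\<^sub>R (A *v v i) = (u i \<bullet> x) *\<^sub>R u i"
      using is_svd_right_vector[OF svd, of i] \<sigma>[of i] q ec by simp
  qed
  also have "\<dots> = x" by (rule orthonormal_expansion[OF u x(1)])
  finally have Ay: "A *v y = x" .
  have "(norm y)\<^sup>2 = (\<Sum>i<q. ((u i \<bullet> x) / \<sigma> i)\<^sup>2)"
    unfolding y_def by (rule norm_sum_orthonormal[OF v])
  also have "\<dots> \<le> (\<Sum>i<q. (1 / (c - e))\<^sup>2 * (u i \<bullet> x)\<^sup>2)"
  proof (intro sum_mono)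
    fix i assume "i \<in> {..<q}"
    then have "(1 / \<sigma> i)\<^sup>2 \<le> (1 / (c - e))\<^sup>2"
      using \<sigma>[of i] ec by (intro power_mono divide_left_mono) (auto intro!: mult_pos_pos)
    then have "(1 / \<sigma> i)\<^sup>2 * (u i \<bullet> x)\<^sup>2 \<le> (1 / (c - e))\<^sup>2 * (u i \<bullet> x)\<^sup>2"
      by (intro mult_right_mono) auto
    then show "((u i \<bullet> x) / \<sigma> i)\<^sup>2 \<le> (1 / (c - e))\<^sup>2 * (u i \<bullet> x)\<^sup>2"
      by (simp add: power_divide)
  qed
  also have "\<dots> \<le> (1 / (c - e))\<^sup>2 * (norm x)\<^sup>2"
    unfolding sum_distrib_left[symmetric] by (intro mult_left_mono bessel_inequality u) simp
  finally have "(norm y)\<^sup>2 \<le> (1 / (c - e))\<^sup>2" by (simp only: x(2) one_power2 mult_1_right)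
  then have "norm y \<le> 1 / (c - e)" by (rule power2_le_imp_le) (use ec in simp)
  then have "e * norm y \<le> e * (1 / (c - e))" using ec by (intro mult_left_mono) auto
  then have "norm (x - B *v y) \<le> e / (c - e)" using close[of y] Ay by simp
  then show ?thesis ..
qed

section \<open>Principal angles\<close>

lemma orthonormal_basis_matrix_exists:
  fixes V :: "(real^'m) set"
  assumes "subspace V" "dim V = CARD('p)"
  shows "\<exists>Q::real^'p^'m. orthonormal_basis_matrix Q V"
proof -
  obtain B where B: "B \<subseteq> V" "pairwise orthogonal B" "\<And>x. x \<in> B \<Longrightarrow> norm x = 1"
    "independent B" "card B = dim V" "span B = V"
    using orthonormal_basis_subspace[OF assms(1)] by blast
  have "finite B" using B(4) by (rule independent_imp_finite)
  then obtain g :: "'p \<Rightarrow> real^'m" where g: "bij_betw g UNIV B"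
    using finite_same_card_bij[of "UNIV::'p set" B] B(5) assms(2) by auto
  define Q :: "real^'p^'m" where "Q = (\<chi> a j. g j $ a)"
  have col: "column j Q = g j" for j by (simp add: Q_def column_def vec_eq_iff)
  have "g i \<bullet> g j = (if i = j then 1 else 0)" for i j
  proof (cases "i = j")
    case True
    then show ?thesis using B(3)[of "g j"] g by (auto simp: bij_betw_def norm_eq_1)
  next
    case False
    then have "g i \<noteq> g j" "g i \<in> B" "g j \<in> B"
      using g by (auto simp: bij_betw_def inj_on_def)
    then show ?thesis using B(2) False by (auto simp: pairwise_def orthogonal_def)
  qed
  then have "transpose Q ** Q = mat 1"
    by (simp add: vec_eq_iff matrix_matrix_mult_def transpose_def mat_def Q_def inner_vec_def)
  moreover have "columns Q = B"
    using g col by (auto simp: columns_def bij_betw_def)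
  ultimately show ?thesis using B(6) by (auto simp: orthonormal_basis_matrix_def)
qed

lemma span_columns_eq_range:
  fixes A :: "real^'n^'m"
  shows "span (columns A) = range ((*v) A)"
proof
  show "range ((*v) A) \<subseteq> span (columns A)"
    using matrix_vector_mult_in_columnspace by blast
  have "columns A \<subseteq> range ((*v) A)"
    by (auto simp: columns_image_basis)
  then show "span (columns A) \<subseteq> range ((*v) A)"
    by (intro span_minimal) (auto intro: linear_subspace_image)
qed

lemma orthonormal_basis_matrix_mult:
  assumes "orthonormal_basis_matrix Q V"
  shows "(Q *v x) v* Q = x" and "norm (Q *v x) = norm x" and "Q *v x \<in> V"
    and "t \<in> V \<Longrightarrow> \<exists>y. t = Q *v y"
proof -
  have "(Q *v x) v* Q = transpose Q *v (Q *v x)" by simp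
  also have "\<dots> = x"
    using assms by (simp only: matrix_vector_mul_assoc orthonormal_basis_matrix_def matrix_vector_mul_lid)
  finally show *: "(Q *v x) v* Q = x" .
  show "norm (Q *v x) = norm x"
    using dot_lmul_matrix[of "Q *v x" Q x] * by (simp add: norm_eq_sqrt_inner)
  show "Q *v x \<in> V" "t \<in> V \<Longrightarrow> \<exists>y. t = Q *v y"
    using assms span_columns_eq_range[of Q] by (auto simp: orthonormal_basis_matrix_def)
qed

text \<open>
  Pythagoras: \<open>x v* R\<close> are the coordinates of the orthogonal projection of \<open>x\<close> onto \<open>V\<close>, so the
  distance of \<open>x\<close> to any point of \<open>V\<close> is controlled from below by the loss of norm in projecting.
\<close>

lemma norm_diff_basis_matrix:
  assumes "orthonormal_basis_matrix R V"
  shows "(norm (x - R *v y))\<^sup>2 = (norm x)\<^sup>2 - (norm (x v* R))\<^sup>2 + (norm (x v* R - y))\<^sup>2"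
proof -
  have "(R *v y) \<bullet> (R *v y) = y \<bullet> y"
    using orthonormal_basis_matrix_mult(2)[OF assms, of y] by (metis power2_norm_eq_inner)
  then show ?thesis
    using dot_lmul_matrix[of x R y]
    by (simp add: power2_norm_eq_inner inner_diff_left inner_diff_right inner_commute)
qed

text \<open>
  A left singular vector of \<open>transpose Q ** R\<close> gives, through \<open>Q\<close>, a unit vector \<open>x\<close> of \<open>\<U>\<close> whose
  projection onto \<open>\<V>\<close> has the singular value, that is the cosine of the angle, as its norm. The
  sine is then the distance from \<open>x\<close> to \<open>\<V>\<close>. Only this one-sided distance is needed because
  the two subspaces have the same dimension.
\<close>

lemma sin_principal_angle_le:
  fixes \<U> \<V> :: "(real^'m) set" and i :: "'p::{finite,linorder}"
  assumes U: "subspace \<U>" "dim \<U> = CARD('p::{finite,linorder})" and V: "subspace \<V>" "dim \<V> = CARD('p::{finite,linorder})"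
    and near: "\<And>x. x \<in> \<U> \<Longrightarrow> norm x = 1 \<Longrightarrow> \<exists>t\<in>\<V>. norm (x - t) \<le> \<delta>"
  shows "\<bar>sin (principal_angles \<U> \<V> $ i)\<bar> \<le> \<delta>"
proof -
  define Q where "Q = (SOME Q :: real^'p::{finite,linorder}^'m. orthonormal_basis_matrix Q \<U>)"
  define R where "R = (SOME R :: real^'p::{finite,linorder}^'m. orthonormal_basis_matrix R \<V>)"
  have Q: "orthonormal_basis_matrix Q \<U>"
    unfolding Q_def by (rule someI_ex[OF orthonormal_basis_matrix_exists[OF U]])
  have R: "orthonormal_basis_matrix R \<V>"
    unfolding R_def by (rule someI_ex[OF orthonormal_basis_matrix_exists[OF V]])
  define M where "M = transpose Q ** R"
  define j where "j = card {..<i}"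
  have "{..<i} \<subset> UNIV" by blast
  then have j: "j < CARD('p::{finite,linorder})" unfolding j_def by (intro psubset_card_mono) auto
  obtain \<sigma> u v where \<sigma>_eq: "\<sigma> = singular_value M" and svd: "is_svd M u \<sigma> v"
    using someI_ex[of "\<lambda>\<sigma>. \<exists>u v. is_svd M u \<sigma> v"] svd_exists[of M]
    unfolding singular_value_def by blast
  have \<sigma>0: "0 \<le> \<sigma> j" using svd j unfolding is_svd_def Let_def by simp
  have uv: "norm (u j) = 1" "norm (v j) = 1"
    using is_svd_orthonormal[OF svd] j by (auto intro: orthonormal_upto_norm)
  define x where "x = Q *v u j"
  have x: "x \<in> \<U>" "norm x = 1"
    using orthonormal_basis_matrix_mult[OF Q] uv by (auto simp: x_def)
  have "x v* R = transpose R *v (transpose (transpose Q) *v u j)" by (simp add: x_def)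
  also have "\<dots> = u j v* M"
    unfolding M_def
    by (metis matrix_transpose_mul matrix_vector_mul_assoc transpose_matrix_vector transpose_transpose)
  also have "\<dots> = \<sigma> j *\<^sub>R v j" using is_svd_left_vector[OF svd] j by simp
  finally have nR: "norm (x v* R) = \<sigma> j" using uv \<sigma>0 by simp
  have dist: "1 - (\<sigma> j)\<^sup>2 \<le> (norm (x - R *v y))\<^sup>2" for y
    unfolding norm_diff_basis_matrix[OF R, of x y] nR x(2) by simp
  have "0 \<le> 1 - (\<sigma> j)\<^sup>2"
    using norm_diff_basis_matrix[OF R, of x "x v* R"] nR x(2)
    by (metis add.right_neutral diff_self norm_zero one_power2 power_zero_numeral zero_le_power2)
  then have \<sigma>1: "\<sigma> j \<le> 1" using power2_le_imp_le[of "\<sigma> j" 1] by simp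
  obtain t where t: "t \<in> \<V>" "norm (x - t) \<le> \<delta>" using near[OF x] by blast
  then obtain y where "t = R *v y" using orthonormal_basis_matrix_mult(4)[OF R] by blast
  then have "sqrt (1 - (\<sigma> j)\<^sup>2) \<le> \<delta>"
    using dist[of y] t(2) by (intro order_trans[OF real_le_lsqrt t(2)]) auto
  moreover have "principal_angles \<U> \<V> $ i = arccos (\<sigma> j)"
    by (simp add: principal_angles_def Q_def R_def M_def j_def \<sigma>_eq Let_def)
  ultimately show ?thesis using \<sigma>0 \<sigma>1 \<open>0 \<le> 1 - (\<sigma> j)\<^sup>2\<close> by (simp add: sin_arccos)
qed

section \<open>Norms of diagonal matrices\<close>

lemma submult_unitarily_invariant_norm_sum:
  assumes N: "submult_unitarily_invariant_norm N" and "finite I"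
  shows "N (\<Sum>i\<in>I. c i *\<^sub>R E i) \<le> (\<Sum>i\<in>I. \<bar>c i\<bar> * N (E i))"
  using assms(2)
proof (induction I rule: finite_induct)
  case empty
  have "N 0 = 0" using N unfolding submult_unitarily_invariant_norm_def by blast
  then show ?case by simp
next
  case (insert i I)
  have "N (c i *\<^sub>R E i + (\<Sum>i\<in>I. c i *\<^sub>R E i)) \<le> N (c i *\<^sub>R E i) + N (\<Sum>i\<in>I. c i *\<^sub>R E i)"
    and "N (c i *\<^sub>R E i) = \<bar>c i\<bar> * N (E i)"
    using N unfolding submult_unitarily_invariant_norm_def by blast+
  then show ?case using insert by simp
qed

lemma submult_unitarily_invariant_norm_nonneg:
  assumes N: "submult_unitarily_invariant_norm N"
  shows "0 \<le> N A"
proof -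
  have "N 0 = 0" "N (A + (-1) *\<^sub>R A) \<le> N A + N ((-1) *\<^sub>R A)" "N ((-1) *\<^sub>R A) = \<bar>-1\<bar> * N A"
    using N unfolding submult_unitarily_invariant_norm_def by blast+
  then show ?thesis by simp
qed

text \<open>
  Expanding a diagonal matrix in the diagonal matrix units reduces an arbitrary norm to a bound on
  the individual sines.
\<close>

lemma norm_sin_Theta_bounded:
  fixes N :: "real^'p::{finite,linorder}^'p::{finite,linorder} \<Rightarrow> real"
  assumes N: "submult_unitarily_invariant_norm N"
  obtains K where "K \<ge> 0"
    "\<And>(\<U>::(real^'m) set) \<V> \<delta>. (\<And>i. \<bar>sin ((principal_angles \<U> \<V> :: real^'p::{finite,linorder}) $ i)\<bar> \<le> \<delta>)
        \<Longrightarrow> N (sin_Theta \<U> \<V>) \<le> K * \<delta>"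
proof
  define E :: "'p::{finite,linorder} \<Rightarrow> real^'p::{finite,linorder}^'p::{finite,linorder}" where "E i = (\<chi> a b. if a = i \<and> b = i then 1 else 0)" for i
  define K where "K = (\<Sum>i\<in>UNIV. N (E i))"
  show "K \<ge> 0" unfolding K_def by (intro sum_nonneg submult_unitarily_invariant_norm_nonneg[OF N])
  fix \<U> \<V> :: "(real^'m) set" and \<delta>
  let ?s = "\<lambda>i. sin ((principal_angles \<U> \<V> :: real^'p::{finite,linorder}) $ i)"
  assume le: "\<And>i. \<bar>?s i\<bar> \<le> \<delta>"
  have "sin_Theta \<U> \<V> $ a $ b = (\<Sum>i\<in>UNIV. ?s i *\<^sub>R E i) $ a $ b" for a b
  proof -
    have "(\<Sum>i\<in>UNIV. ?s i *\<^sub>R E i) $ a $ b = (\<Sum>i\<in>UNIV. if i = a then (if a = b then ?s a else 0) else 0)"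
      unfolding sum_component by (intro sum.cong) (auto simp: E_def)
    then show ?thesis by (simp add: sin_Theta_def)
  qed
  then have "sin_Theta \<U> \<V> = (\<Sum>i\<in>UNIV. ?s i *\<^sub>R E i)" by (simp add: vec_eq_iff)
  then have "N (sin_Theta \<U> \<V>) \<le> (\<Sum>i\<in>UNIV. \<bar>?s i\<bar> * N (E i))"
    using submult_unitarily_invariant_norm_sum[OF N, of UNIV ?s E] by simp
  also have "\<dots> \<le> (\<Sum>i\<in>UNIV. \<delta> * N (E i))"
    by (intro sum_mono mult_right_mono le submult_unitarily_invariant_norm_nonneg[OF N])
  finally show "N (sin_Theta \<U> \<V>) \<le> K * \<delta>"
    by (simp add: K_def sum_distrib_left mult.commute)
qed

section \<open>The snapshot matrix to second order\<close>

text \<open>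
  Differentiability at \<open>0\<close> makes the directional derivative vary by \<open>O(\<bar>y\<bar>)\<close> near \<open>0\<close>, and the mean value
  inequality along the segment from \<open>0\<close> to \<open>r h\<close> gains the second factor \<open>r\<close>.
\<close>

lemma taylor_remainder_quadratic:
  fixes f :: "'a::real_normed_vector \<Rightarrow> 'b::real_normed_vector"
  assumes f: "\<And>y. y \<in> Q \<Longrightarrow> f differentiable (at y)"
    and f': "(\<lambda>y. frechet_derivative f (at y) h) differentiable (at 0)"
    and Q: "open Q" "0 \<in> Q"
  obtains C where "C \<ge> 0"
    "\<forall>\<^sub>F r in at_right 0. norm (f (r *\<^sub>R h) - f 0 - r *\<^sub>R frechet_derivative f (at 0) h) \<le> C * r\<^sup>2"
proof -
  define g where "g y = frechet_derivative f (at y) h" for y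
  have "g differentiable (at 0)" using f' by (simp add: g_def[abs_def])
  then obtain g' where g': "(g has_derivative g') (at 0)" by (auto simp: differentiable_def)
  then have bl: "bounded_linear g'" by (rule has_derivative_bounded_linear)
  obtain B where B: "B > 0" "\<And>y. norm (g' y) \<le> norm y * B"
    using bounded_linear.pos_bounded[OF bl] by blast
  obtain d where d: "d > 0" "\<And>y. norm y < d \<Longrightarrow> norm (g y - g 0 - g' y) \<le> norm y"
    using g' unfolding has_derivative_at_alt by (auto dest!: spec[of _ 1])
  have glip: "norm (g y - g 0) \<le> (B + 1) * norm y" if "norm y < d" for y
  proof -
    have "norm (g y - g 0) \<le> norm (g y - g 0 - g' y) + norm (g' y)"
      using norm_triangle_ineq[of "g y - g 0 - g' y" "g' y"] by simp
    then show ?thesis using d(2)[OF that] B(2)[of y] by (simp add: algebra_simps)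
  qed
  obtain e where e: "e > 0" "ball 0 e \<subseteq> Q" using Q open_contains_ball by blast
  define C where "C = (B + 1) * norm h"
  \<comment> \<open>The added \<open>1\<close> admits \<open>h = 0\<close>.\<close>
  define \<rho> where "\<rho> = min d e / (norm h + 1)"
  have \<rho>: "\<rho> > 0" using d e by (simp add: \<rho>_def add_nonneg_pos)
  have "norm (f (r *\<^sub>R h) - f 0 - r *\<^sub>R g 0) \<le> C * r\<^sup>2" if r: "0 < r" "r < \<rho>" for r
  proof -
    have small: "norm (t *\<^sub>R h) < min d e" "norm (t *\<^sub>R h) \<le> r * norm h" if "t \<in> {0..r}" for t
    proof -
      show "norm (t *\<^sub>R h) \<le> r * norm h" using that by (auto intro: mult_right_mono)
      also have "\<dots> \<le> r * (norm h + 1)" using r by simp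
      also have "\<dots> < min d e"
        using r(2) unfolding \<rho>_def by (simp add: pos_less_divide_eq add_nonneg_pos)
      finally show "norm (t *\<^sub>R h) < min d e" .
    qed
    have der: "((\<lambda>t. f (t *\<^sub>R h)) has_vector_derivative g (t *\<^sub>R h)) (at t within {0..r})"
      if "t \<in> {0..r}" for t
    proof -
      have "t *\<^sub>R h \<in> Q" using small(1)[OF that] e(2) by auto
      then have F: "(f has_derivative frechet_derivative f (at (t *\<^sub>R h))) (at (t *\<^sub>R h))"
        using f frechet_derivative_works by blast
      have "((\<lambda>t. f (t *\<^sub>R h)) has_derivative (\<lambda>s. frechet_derivative f (at (t *\<^sub>R h)) (s *\<^sub>R h))) (at t within {0..r})"
        by (rule has_derivative_compose[where g = f and f = "\<lambda>t. t *\<^sub>R h", OF _ F])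
          (auto intro!: derivative_eq_intros)
      then show ?thesis
        unfolding has_vector_derivative_def g_def
        using linear_scale[OF has_derivative_linear[OF F]] by simp
    qed
    have "norm (f (r *\<^sub>R h) - f (0 *\<^sub>R h) - (r - 0) *\<^sub>R g (0 *\<^sub>R h)) \<le> norm (r - 0) * ((B + 1) * (r * norm h))"
    proof (rule vector_differentiable_bound_linearization[OF der])
      show "closed_segment 0 r \<subseteq> {0..r}" using r by (simp add: closed_segment_eq_real_ivl)
      fix t assume t: "t \<in> {0..r}"
      have "norm (g (t *\<^sub>R h) - g 0) \<le> (B + 1) * norm (t *\<^sub>R h)" using small(1)[OF t] by (intro glip) simp
      also have "\<dots> \<le> (B + 1) * (r * norm h)" using small[OF t] B by (intro mult_left_mono) auto
      finally show "norm (g (t *\<^sub>R h) - g (0 *\<^sub>R h)) \<le> (B + 1) * (r * norm h)" by simp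
    qed (use r in auto)
    then show ?thesis using r by (simp add: C_def power2_eq_square algebra_simps)
  qed
  moreover have "C \<ge> 0" using B by (simp add: C_def)
  ultimately show thesis
    using that \<rho> unfolding g_def eventually_at_right_field by blast
qed

lemma snapshot_matrix_mult:
  "snapshot_matrix U p \<nu> r *v x = (\<Sum>i\<in>UNIV. x $ i *\<^sub>R (U (r *\<^sub>R \<nu> i) - p))"
  by (simp add: vec_eq_iff snapshot_matrix_def matrix_vector_mult_def mult.commute)

lemma snapshot_matrix_linearization:
  fixes U :: "real^'q \<Rightarrow> real^'m" and \<nu> :: "'n::finite \<Rightarrow> real^'q"
  assumes "open Q" "0 \<in> Q" and U: "Ck_on (Suc (Suc k)) U Q"
  defines "B \<equiv> jacobian U (at 0) ** (\<chi> a i. \<nu> i $ a)"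
  obtains C where "C \<ge> 0"
    "\<forall>\<^sub>F r in at_right 0. \<forall>x. norm (snapshot_matrix U (U 0) \<nu> r *v x - (r *\<^sub>R B) *v x) \<le> C * r\<^sup>2 * norm x"
proof -
  define D where "D = frechet_derivative U (at 0)"
  have Ud: "\<And>y. y \<in> Q \<Longrightarrow> U differentiable (at y)"
    and Udd: "(\<lambda>y. frechet_derivative U (at y) h) differentiable (at 0)" for h
    using U \<open>0 \<in> Q\<close> by auto
  have "\<exists>C\<ge>0. \<forall>\<^sub>F r in at_right 0. norm (U (r *\<^sub>R \<nu> i) - U 0 - r *\<^sub>R D (\<nu> i)) \<le> C * r\<^sup>2" for i
    using taylor_remainder_quadratic[OF Ud Udd assms(1,2), of "\<nu> i"] unfolding D_def by blast
  then have "\<exists>C. \<forall>i. C i \<ge> 0 \<and>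
      (\<forall>\<^sub>F r in at_right 0. norm (U (r *\<^sub>R \<nu> i) - U 0 - r *\<^sub>R D (\<nu> i)) \<le> C i * r\<^sup>2)"
    by (intro choice) auto
  then obtain C where C: "\<And>i. C i \<ge> 0"
    "\<And>i. \<forall>\<^sub>F r in at_right 0. norm (U (r *\<^sub>R \<nu> i) - U 0 - r *\<^sub>R D (\<nu> i)) \<le> C i * r\<^sup>2"
    by blast
  have D: "linear D" "D y = jacobian U (at 0) *v y" for y
  proof -
    show "linear D"
      using Ud[OF \<open>0 \<in> Q\<close>] unfolding D_def by (simp add: linear_frechet_derivative)
    then show "D y = jacobian U (at 0) *v y"
      by (simp add: D_def jacobian_def matrix_works linear_matrix_vector_mul_eq)
  qed
  have B: "B *v x = (\<Sum>i\<in>UNIV. x $ i *\<^sub>R D (\<nu> i))" for x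
  proof -
    have "(\<chi> a i. \<nu> i $ a) *v x = (\<Sum>i\<in>UNIV. x $ i *\<^sub>R \<nu> i)"
      by (simp add: vec_eq_iff matrix_vector_mult_def mult.commute)
    then have "B *v x = D (\<Sum>i\<in>UNIV. x $ i *\<^sub>R \<nu> i)"
      by (simp only: B_def D(2) matrix_vector_mul_assoc[symmetric])
    then show ?thesis by (simp add: linear_sum[OF D(1)] linear_scale[OF D(1)])
  qed
  define K where "K = (\<Sum>i\<in>UNIV. C i)"
  have "\<forall>\<^sub>F r in at_right 0. \<forall>i. norm (U (r *\<^sub>R \<nu> i) - U 0 - r *\<^sub>R D (\<nu> i)) \<le> C i * r\<^sup>2"
    by (intro eventually_all_finite C)
  then have "\<forall>\<^sub>F r in at_right 0. \<forall>x. norm (snapshot_matrix U (U 0) \<nu> r *v x - (r *\<^sub>R B) *v x) \<le> K * r\<^sup>2 * norm x"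
  proof (rule eventually_mono, intro allI)
    fix r x
    assume le: "\<forall>i. norm (U (r *\<^sub>R \<nu> i) - U 0 - r *\<^sub>R D (\<nu> i)) \<le> C i * r\<^sup>2"
    have "snapshot_matrix U (U 0) \<nu> r *v x - (r *\<^sub>R B) *v x
        = (\<Sum>i\<in>UNIV. x $ i *\<^sub>R (U (r *\<^sub>R \<nu> i) - U 0 - r *\<^sub>R D (\<nu> i)))"
      unfolding snapshot_matrix_mult scaleR_matrix_vector_assoc[symmetric] B scaleR_sum_right
        sum_subtractf[symmetric]
      by (intro sum.cong) (auto simp: algebra_simps)
    also have "norm \<dots> \<le> (\<Sum>i\<in>UNIV. norm x * (C i * r\<^sup>2))"
    proof (rule sum_norm_le)
      fix i
      show "norm (x $ i *\<^sub>R (U (r *\<^sub>R \<nu> i) - U 0 - r *\<^sub>R D (\<nu> i))) \<le> norm x * (C i * r\<^sup>2)"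
        unfolding norm_scaleR using le component_le_norm_cart[of x i] by (intro mult_mono) auto
    qed
    also have "\<dots> = K * r\<^sup>2 * norm x"
      by (simp add: K_def sum_distrib_left sum_distrib_right mult_ac)
    finally show "norm (snapshot_matrix U (U 0) \<nu> r *v x - (r *\<^sub>R B) *v x) \<le> K * r\<^sup>2 * norm x" .
  qed
  moreover have "K \<ge> 0" unfolding K_def by (intro sum_nonneg C(1))
  ultimately show thesis using that by blast
qed

text \<open>
  The kernel of \<open>J ** P\<close> is that of \<open>P\<close>, the orthogonal complement of the row space of \<open>P\<close>.
\<close>

lemma bounded_below_on_row_space:
  fixes J :: "real^'q^'m" and P :: "real^'n^'q"
  assumes J: "inj ((*v) J)"
  obtains c where "c > 0" "\<And>x. x \<in> range ((*v) (transpose P)) \<Longrightarrow> c * norm x \<le> norm ((J ** P) *v x)"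
proof -
  let ?W = "range ((*v) (transpose P))"
  have W: "subspace ?W" by (intro linear_subspace_image) auto
  have "\<exists>e>0. \<forall>x\<in>?W. norm ((J ** P) *v x) \<ge> e * norm x"
  proof (rule injective_imp_isometric[OF closed_subspace[OF W] W], simp, intro ballI impI)
    fix x assume x: "x \<in> ?W" and "(J ** P) *v x = 0"
    then have "J *v (P *v x) = J *v 0" by (simp add: matrix_vector_mul_assoc)
    then have Px: "P *v x = 0" by (rule injD[OF J])
    obtain y where "x = y v* P" using x by auto
    then have "x \<bullet> x = y \<bullet> (P *v x)" by (metis dot_lmul_matrix)
    then show "x = 0" using Px by simp
  qed
  then show thesis using that by blast
qed

lemma span_partial_deriv:
  fixes f :: "real^'q \<Rightarrow> real^'m"
  assumes "f differentiable (at x)"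
  shows "span (range (\<lambda>j. partial_deriv j f x)) = range ((*v) (jacobian f (at x)))"
proof -
  have "column j (jacobian f (at x)) = partial_deriv j f x" for j
    by (simp add: column_def jacobian_def matrix_def partial_deriv_def vec_eq_iff)
  then have "range (\<lambda>j. partial_deriv j f x) = columns (jacobian f (at x))"
    by (auto simp: columns_def)
  then show ?thesis by (simp add: span_columns_eq_range)
qed

section \<open>Convergence of the leading singular subspace to the tangent space\<close>

theorem mainTheorem3:
  fixes S :: "(real^'m) set" and ustar :: "real^'m"
    and Q0 :: "(real^'q::{finite,linorder}) set"
    and U :: "real^'q::{finite,linorder} \<Rightarrow> real^'m"
    and \<nu> :: "'n::finite \<Rightarrow> real^'q::{finite,linorder}"
    and u :: "real \<Rightarrow> nat \<Rightarrow> real^'m"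
    and \<sigma> :: "real \<Rightarrow> nat \<Rightarrow> real"
    and v :: "real \<Rightarrow> nat \<Rightarrow> real^'n"
    and N :: "real^'q::{finite,linorder}^'q::{finite,linorder} \<Rightarrow> real"
    and k :: nat
  assumes "k \<ge> 1" and "embedded_submanifold k CARD('q::{finite,linorder}) S" and "ustar \<in> S"
    and "inverse_chart S ustar Q0 U"
    and "Ck_on 3 U Q0"
    and "\<And>x. x \<in> Q0 \<Longrightarrow> rank (jacobian U (at x)) = CARD('q::{finite,linorder})"
    and "\<And>x. x \<in> Q0 \<Longrightarrow> full_rank_second_fundamental_form U x"
    and "\<And>i. \<nu> i \<in> ball 0 1"
    and "rank (\<chi> a i. \<nu> i $ a) = CARD('q::{finite,linorder})"
    and "\<forall>\<^sub>F r in at_right 0. is_svd (snapshot_matrix U ustar \<nu> r) (u r) (\<sigma> r) (v r)"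
    and "submult_unitarily_invariant_norm N"
  shows "(\<lambda>r. N (sin_Theta (span (u r ` {..<CARD('q::{finite,linorder})}))
                          (span (range (\<lambda>j. partial_deriv j U 0)))))
           \<in> O[at_right 0](\<lambda>r. r)"
proof -
  let ?q = "CARD('q::{finite,linorder})"
  define J where "J = jacobian U (at 0)"
  define P :: "real^'n^'q::{finite,linorder}" where "P = (\<chi> a i. \<nu> i $ a)"
  define T where "T = span (range (\<lambda>j. partial_deriv j U 0))"
  have Q0: "open Q0" "0 \<in> Q0" "U 0 = ustar"
    using assms(4) by (auto simp: inverse_chart_def)
  have Ck: "Ck_on (Suc (Suc 1)) U Q0" using assms(5) by (simp add: numeral_3_eq_3)
  have rkJ: "rank J = ?q" using assms(6) Q0(2) by (simp add: J_def)
  have rkP: "rank P = ?q" using assms(9) by (simp add: P_def)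
  have q_le: "?q \<le> min CARD('m) CARD('n)"
    using rank_bound[of J] rank_bound[of P] rkJ rkP by simp
  have T: "T = range ((*v) J)"
    unfolding T_def J_def using Ck Q0(2) by (intro span_partial_deriv) simp
  have dimT: "dim T = ?q" using rkJ by (simp add: T rank_dim_range)
  define W where "W = range ((*v) (transpose P))"
  have W: "subspace W" unfolding W_def by (intro linear_subspace_image) auto
  have dimW: "dim W = ?q"
    unfolding W_def using rkP rank_transpose[of P] rank_dim_range[of "transpose P"] by metis
  obtain c where c: "c > 0" "\<And>x. x \<in> W \<Longrightarrow> c * norm x \<le> norm ((J ** P) *v x)"
    using bounded_below_on_row_space[OF full_rank_injective[THEN iffD1, OF rkJ], of P]
    unfolding W_def by blast
  obtain C where C: "C \<ge> 0"
    "\<forall>\<^sub>F r in at_right 0. \<forall>x. norm (snapshot_matrix U ustar \<nu> r *v x - (r *\<^sub>R (J ** P)) *v x) \<le> C * r\<^sup>2 * norm x"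
    using snapshot_matrix_linearization[OF Q0(1,2) Ck, of \<nu>] unfolding J_def P_def Q0(3) by blast
  obtain K where K: "K \<ge> 0"
    "\<And>(\<U>::(real^'m) set) \<V> \<delta>. (\<And>i. \<bar>sin ((principal_angles \<U> \<V> :: real^'q::{finite,linorder}) $ i)\<bar> \<le> \<delta>)
        \<Longrightarrow> N (sin_Theta \<U> \<V>) \<le> K * \<delta>"
    using norm_sin_Theta_bounded[OF assms(11)] by blast
  \<comment> \<open>Below this radius the error \<open>C * r\<^sup>2\<close> is less than half of \<open>r * c\<close>; the added \<open>1\<close> admits \<open>C = 0\<close>.\<close>
  define \<rho> where "\<rho> = c / (2 * C + 1)"
  have "\<rho> > 0" using c C by (simp add: \<rho>_def)
  then have "\<forall>\<^sub>F r in at_right 0. 0 < r \<and> r < \<rho>"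
    unfolding eventually_at_right_field by blast
  with C(2) assms(10) have "\<forall>\<^sub>F r in at_right 0.
      norm (N (sin_Theta (span (u r ` {..<?q})) T)) \<le> K * (2 * C / c) * norm r"
  proof eventually_elim
    case (elim r)
    have r: "0 < r" "r < \<rho>" using elim by auto
    let ?e = "C * r\<^sup>2"
    have "r * (2 * C + 1) < c" using r C by (simp add: \<rho>_def pos_less_divide_eq)
    then have "2 * (C * r) < c" using r by (simp add: algebra_simps)
    then have "r * (2 * (C * r)) < r * c" using r by simp
    then have gap: "2 * ?e < r * c" by (simp add: power2_eq_square algebra_simps)
    have "0 \<le> ?e" using C by simp
    with gap have e: "0 \<le> ?e" "?e < r * c" by linarith+
    have lower: "r * c * norm x \<le> norm ((r *\<^sub>R (J ** P)) *v x)" if "x \<in> W" for x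
    proof -
      have "r * (c * norm x) \<le> r * norm ((J ** P) *v x)" using c(2)[OF that] r by simp
      then show ?thesis using r by (simp add: scaleR_matrix_vector_assoc[symmetric] mult.assoc)
    qed
    let ?\<U> = "span (u r ` {..<?q})"
    have ratio: "?e / (r * c - ?e) \<le> 2 * C / c * r"
    proof -
      have half: "r * c / 2 \<le> r * c - ?e" "0 < r * c / 2" using gap r c by (simp_all add: mult.commute)
      have "?e / (r * c - ?e) \<le> ?e / (r * c / 2)"
        by (rule frac_le[OF e(1) order_refl half(2,1)])
      also have "\<dots> = 2 * C / c * r" using r by (simp add: power2_eq_square)
      finally show ?thesis .
    qed
    have near: "\<exists>t\<in>T. norm (x - t) \<le> 2 * C / c * r" if x: "x \<in> ?\<U>" "norm x = 1" for x
    proof -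
      obtain y where y: "norm (x - (r *\<^sub>R (J ** P)) *v y) \<le> ?e / (r * c - ?e)"
        using leading_singular_subspace_near_range[OF elim(2) W dimW q_le lower elim(1)[rule_format] e x]
        by blast
      have "(r *\<^sub>R (J ** P)) *v y = J *v (r *\<^sub>R (P *v y))"
        by (simp add: scaleR_matrix_vector_assoc[symmetric] matrix_vector_mul_assoc[symmetric]
            matrix_vector_mult_scaleR)
      then have "(r *\<^sub>R (J ** P)) *v y \<in> T" unfolding T by simp
      then show ?thesis using y ratio by (meson order_trans)
    qed
    have "orthonormal_upto ?q (u r)"
      using is_svd_orthonormal(1)[OF elim(2)] q_le by (rule orthonormal_upto_mono)
    then have dimU: "dim ?\<U> = ?q" by (rule dim_span_orthonormal)
    have "subspace T" by (simp add: T_def)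
    then have "N (sin_Theta ?\<U> T) \<le> K * (2 * C / c * r)"
      by (intro K(2) sin_principal_angle_le[OF subspace_span dimU _ dimT near])
    moreover have "0 \<le> N (sin_Theta ?\<U> T)"
      by (rule submult_unitarily_invariant_norm_nonneg[OF assms(11)])
    ultimately show ?case using r by (simp add: mult.assoc)
  qed
  then show ?thesis unfolding T_def by (rule bigoI)
qed

end
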